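(* For all $m,k\in\mathbb{N}$, $$Ch_m^{(k)}(x)=\sum_{n=0}^m(-1)^{m-n}\binom{m}{n}\frac{(k+m-n-1)!}{(k-1)!}\,\widehat{Ch}_n^{(k)}(x).$$
   Context: For $k\in\mathbb{N}$, the Changhee polynomials of the first kind with order $k$, $Ch_n^{(k)}(x)$, and of the second kind with order $k$, $\widehat{Ch}_n^{(k)}(x)$, $n\ge0$, are defined by the generating functions (identities of formal power series in $t$, with $x$ an indeterminate) $$\sum_{n=0}^\infty Ch_n^{(k)}(x)\frac{t^n}{n!}=\left(\frac{2}{2+t}\right)^k(1+t)^x,\qquad \sum_{n=0}^\infty \widehat{Ch}_n^{(k)}(x)\frac{t^n}{n!}=\left(\frac{2}{2+t}\right)^k(1+t)^{x+k}.$$ Here $(1+t)^x=\sum_{j\ge0}\binom{x}{j}t^j$ with $\binom{x}{j}=\frac{x(x-1)\cdots(x-j+1)}{j!}$. $\mathbb{N}$ denotes the positive integers. *)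

theory Defs
  imports "HOL-Computational_Algebra.Computational_Algebra"
begin

text \<open>
  The indeterminate \<open>x\<close> of the Changhee polynomials is the variable of the type \<open>'a poly\<close>, where
  \<open>'a\<close> is any field of characteristic 0, and the generating functions are power series in
  \<open>t = fps_X\<close> over that polynomial ring.
\<close>

text \<open>
  The factor \<open>(2 / (2 + t)) ^ k\<close> does not involve \<open>x\<close>. It is formed over the field \<open>'a\<close>, because the
  library divides power series only over a coefficient type with inverses, and is then embedded.
\<close>

definition fps_lift_poly :: "'a::zero fps \<Rightarrow> 'a poly fps" where
  "fps_lift_poly f = Abs_fps (\<lambda>n. [:fps_nth f n:])"

text \<open>
  The library's \<open>gchoose\<close> and \<open>fps_binomial\<close> take their upper argument and exponent in a field of
  characteristic 0; here these are polynomials in \<open>x\<close>. Evaluation at a point recovers \<open>gchoose\<close>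
  (see \<open>poly_gchoose_poly\<close>).
\<close>

definition gchoose_poly :: "'a::field_char_0 poly \<Rightarrow> nat \<Rightarrow> 'a poly" where
  "gchoose_poly p j = smult (1 / fact j) (\<Prod>i = 0..<j. p - of_nat i)"

definition fps_binomial_poly :: "'a::field_char_0 poly \<Rightarrow> 'a poly fps" where
  "fps_binomial_poly p = Abs_fps (gchoose_poly p)"

definition changhee_gf1 :: "nat \<Rightarrow> 'a::field_char_0 poly fps" where
  "changhee_gf1 k = fps_lift_poly ((2 / (2 + fps_X)) ^ k) * fps_binomial_poly [:0, 1:]"

definition changhee_gf2 :: "nat \<Rightarrow> 'a::field_char_0 poly fps" where
  "changhee_gf2 k = fps_lift_poly ((2 / (2 + fps_X)) ^ k) * fps_binomial_poly ([:0, 1:] + of_nat k)"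

definition changhee1 :: "nat \<Rightarrow> nat \<Rightarrow> 'a::field_char_0 poly" where
  "changhee1 k n = fact n * fps_nth (changhee_gf1 k) n"

definition changhee2 :: "nat \<Rightarrow> nat \<Rightarrow> 'a::field_char_0 poly" where
  "changhee2 k n = fact n * fps_nth (changhee_gf2 k) n"

lemma fact_poly: "(fact n :: 'a::field_char_0 poly) = [:fact n:]"
  by (metis of_nat_fact of_nat_poly)

lemma poly_gchoose_poly: "poly (gchoose_poly p j) a = poly p a gchoose j"
  by (simp add: gchoose_poly_def poly_prod gbinomial_prod_rev)

lemma fps_lift_poly_mult:
  fixes f g :: "'a::comm_semiring_1 fps"
  shows "fps_lift_poly (f * g) = fps_lift_poly f * fps_lift_poly g"
  by (simp add: fps_eq_iff fps_lift_poly_def fps_mult_nth mult.commute flip: sum_to_poly)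

lemma fps_lift_poly_two_div:
  "fps_lift_poly (2 / (2 + fps_X)) * (2 + fps_X) = (2 :: 'a::field_char_0 poly fps)"
proof -
  have "(2 / (2 + fps_X)) * (2 + fps_X) = (2 :: 'a fps)"
    by (simp add: fps_divide_unit mult.assoc inverse_mult_eq_1 fps_numeral_nth)
  moreover have "fps_lift_poly (2 + fps_X) = (2 + fps_X :: 'a poly fps)"
    by (simp add: fps_eq_iff fps_lift_poly_def fps_X_def fps_numeral_nth numeral_poly one_pCons)
  moreover have "fps_lift_poly 2 = (2 :: 'a poly fps)"
    by (simp add: fps_eq_iff fps_lift_poly_def fps_numeral_nth numeral_poly)
  ultimately show ?thesis
    by (metis fps_lift_poly_mult)
qed

lemma changhee1_gf:
  "Abs_fps (\<lambda>n. smult (1 / fact n) (changhee1 k n)) = changhee_gf1 k"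
  by (simp add: fps_eq_iff changhee1_def fact_poly)

lemma changhee2_gf:
  "Abs_fps (\<lambda>n. smult (1 / fact n) (changhee2 k n)) = changhee_gf2 k"
  by (simp add: fps_eq_iff changhee2_def fact_poly)

end

theory Submission
  imports Defs
begin

text \<open>
  The two generating functions differ only by the factor \<open>(1 + t) ^ k\<close>, so the first is the second
  times \<open>(1 + t) ^ (- k)\<close>. The negative binomial series has coefficients
  \<open>(- 1) ^ j * (k + j - 1)! / (j! * (k - 1)!)\<close>, and comparing coefficients of \<open>t ^ m\<close> in the Cauchy
  product gives the identity, the factorials \<open>m! / (n! * (m - n)!)\<close> that come from the exponential
  normalisation combining to a binomial coefficient.

  What needs proof is the exponent law for \<open>(1 + t) ^ p\<close> when \<open>p\<close> is a polynomial
  (\<open>fps_binomial_poly_add_mult\<close>) and the closed form of the negative binomial coefficients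
  (\<open>gchoose_poly_minus_of_nat\<close>).
\<close>

text \<open>
  The coefficient identity is Vandermonde's. It holds for elements of the infinite field \<open>'a\<close>, hence
  at every value of the indeterminate, and polynomials that agree at every point are equal.
\<close>

lemma fps_binomial_poly_add_mult:
  fixes p q :: "'a::field_char_0 poly"
  shows "fps_binomial_poly (p + q) = fps_binomial_poly p * fps_binomial_poly q"
proof (rule fps_ext)
  fix n
  have "poly (gchoose_poly (p + q) n) a =
      poly (\<Sum>i = 0..n. gchoose_poly p i * gchoose_poly q (n - i)) a" for a
    by (simp add: poly_gchoose_poly poly_sum gbinomial_Vandermonde)
  then have "gchoose_poly (p + q) n = (\<Sum>i = 0..n. gchoose_poly p i * gchoose_poly q (n - i))"
    by (simp add: poly_eq_poly_eq_iff[symmetric] fun_eq_iff)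
  then show "fps_binomial_poly (p + q) $ n = (fps_binomial_poly p * fps_binomial_poly q) $ n"
    by (simp add: fps_binomial_poly_def fps_mult_nth)
qed

text \<open>
  Negating the upper argument turns the coefficient into the ordinary binomial coefficient
  \<open>(k + j - 1) choose j\<close>. For \<open>k = 0\<close> the formula fails at every \<open>j \<ge> 1\<close>: the left-hand side is
  then 0, while truncated subtraction gives \<open>(- 1) ^ j / j\<close> on the right.
\<close>

lemma gchoose_poly_minus_of_nat:
  assumes "k \<ge> 1"
  shows "gchoose_poly (- of_nat k) j =
    [:(- 1) ^ j * fact (k + j - 1) / (fact j * fact (k - 1)) :: 'a::field_char_0:]"
proof -
  have "(- of_nat k :: 'a) gchoose j = (- 1) ^ j * (of_nat (k + j - 1) gchoose j)"
    using assms by (simp add: gbinomial_minus of_nat_diff)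
  also have "(of_nat (k + j - 1) :: 'a) gchoose j = fact (k + j - 1) / (fact j * fact (k - 1))"
    using assms binomial_fact[of j "k + j - 1", where 'a = 'a]
    by (simp only: binomial_gbinomial[symmetric]) simp
  finally have "poly (gchoose_poly (- of_nat k) j) a =
      poly [:(- 1) ^ j * fact (k + j - 1) / (fact j * fact (k - 1)) :: 'a:] a" for a
    by (simp add: poly_gchoose_poly)
  then show ?thesis
    by (simp add: poly_eq_poly_eq_iff[symmetric] fun_eq_iff)
qed

lemma changhee_gf1_eq_gf2_mult:
  "changhee_gf1 k = changhee_gf2 k * fps_binomial_poly (- of_nat k)"
  using fps_binomial_poly_add_mult[of "[:0, 1:] + of_nat k" "- of_nat k :: 'a poly"]
  by (simp add: changhee_gf1_def changhee_gf2_def mult.assoc)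

theorem theorem3p3:
  fixes m k :: nat
  assumes "m \<ge> 1" and "k \<ge> 1"
  shows "(changhee1 k m :: 'a::field_char_0 poly) =
    (\<Sum>n = 0..m. smult ((- 1) ^ (m - n) * of_nat (m choose n) * (fact (k + m - n - 1) / fact (k - 1)))
      (changhee2 k n))"
proof -
  have "(changhee1 k m :: 'a poly) =
      (\<Sum>n = 0..m. fact m * (changhee_gf2 k $ n * gchoose_poly (- of_nat k) (m - n)))"
    by (simp add: changhee1_def changhee_gf1_eq_gf2_mult fps_mult_nth sum_distrib_left
        fps_binomial_poly_def)
  also have "\<dots> = (\<Sum>n = 0..m. smult ((- 1) ^ (m - n) * of_nat (m choose n) *
      (fact (k + m - n - 1) / fact (k - 1))) (changhee2 k n))"
  proof (rule sum.cong[OF refl])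
    fix n assume "n \<in> {0..m}"
    then have "n \<le> m" by simp
    then have "k + (m - n) - 1 = k + m - n - 1" by simp
    with \<open>n \<le> m\<close> show "fact m * (changhee_gf2 k $ n * gchoose_poly (- of_nat k) (m - n)) =
        smult ((- 1) ^ (m - n) * of_nat (m choose n) * (fact (k + m - n - 1) / fact (k - 1)))
          (changhee2 k n :: 'a poly)"
      by (simp add: gchoose_poly_minus_of_nat[OF \<open>k \<ge> 1\<close>] changhee2_def fact_poly binomial_fact
          field_simps)
  qed
  finally show ?thesis .
qed

end
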